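(* Let $\mathcal{N}:\mathbf{Top}^{op}\to\mathbf{Sets}$ be the functor sending a topological space $X$ to the set of isomorphism classes of (non-oriented) continuous families of triangles over $X$ (and a continuous map to pullback of families along it), and let $$N=\{(x,y,z)\in\mathbb{R}^3 \mid 0<x\le y\le z,\ x+y>z\}$$ with the subspace topology. Then $N$ is not a fine moduli space for $\mathcal{N}$; that is, there is no natural isomorphism $\mathcal{N}\cong\mathrm{Hom}_{\mathbf{Top}}(-,N)$.
   Context: $\mathbf{Top}$ is the category of topological spaces and continuous maps. A triangle is a non-degenerate triangle in the Euclidean plane (the convex hull of three non-collinear points) with the Euclidean metric; its endpoints are its three vertices. A continuous map is proper if it is closed and has compact fibers (equivalently, it is universally closed). A (non-oriented) continuous family of triangles over a topological space $X$ is a continuous proper map $p:\mathcal{F}\to X$ making $\mathcal{F}$ a (locally trivial) fiber bundle over $X$, together with a continuous distance map $d:\mathcal{F}\times_X\mathcal{F}\to\mathbb{R}_{\ge0}$ whose restriction to $\mathcal{F}_x\times\mathcal{F}_x$ is, for every $x\in X$, a metric on the fiber $\mathcal{F}_x$ making it isometric to a triangle, and such that there exists a choice, for every $x\in X$, of an ordering $(A_x,B_x,C_x)$ of the three endpoints of the triangle $\mathcal{F}_x$ for which the functions $x\mapsto d(A_x,B_x)$, $x\mapsto d(A_x,C_x)$, $x\mapsto d(B_x,C_x)$ from $X$ to $\mathbb{R}_{\ge0}$ are continuous. The ordering is not part of the data. An isomorphism of such families over $X$ is a homeomorphism over $X$ that restricts to an isometry on each fiber. For a continuous map $f:Y\to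 X$, the map $\mathcal{N}(f)$ sends the class of $\mathcal{F}$ to the class of $\mathcal{F}\times_X Y\to Y$ with the induced distance map. A space $N$ is a fine moduli space for a functor $\mathbf{Top}^{op}\to\mathbf{Sets}$ if the functor is naturally isomorphic to $\mathrm{Hom}_{\mathbf{Top}}(-,N)$. *)

theory Defs
  imports "HOL-Analysis.Analysis"
begin

section \<open>Triangles\<close>

text \<open>Like every \<open>d\<close> below, \<open>d\<close> only matters on \<open>M\<close>. It is cut off outside \<open>M\<close> because
  \<^locale>\<open>Metric_space\<close> demands nonnegativity and symmetry on the whole type.\<close>

definition metric_on :: "'e set \<Rightarrow> ('e \<Rightarrow> 'e \<Rightarrow> real) \<Rightarrow> bool" where
  "metric_on M d \<longleftrightarrow> Metric_space M (\<lambda>a b. if a \<in> M \<and> b \<in> M then d a b else 0)"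

definition isometry_onto ::
  "'e set \<Rightarrow> ('e \<Rightarrow> 'e \<Rightarrow> real) \<Rightarrow> 'p::metric_space set \<Rightarrow> ('e \<Rightarrow> 'p) \<Rightarrow> bool" where
  "isometry_onto M d S h \<longleftrightarrow>
     bij_betw h M S \<and> (\<forall>a\<in>M. \<forall>b\<in>M. dist (h a) (h b) = d a b)"

definition plane_triangle :: "(real^2) set \<Rightarrow> bool" where
  "plane_triangle S \<longleftrightarrow> (\<exists>a b c. \<not> collinear {a, b, c} \<and> S = convex hull {a, b, c})"

definition isometric_to_triangle :: "'e set \<Rightarrow> ('e \<Rightarrow> 'e \<Rightarrow> real) \<Rightarrow> bool" where
  "isometric_to_triangle M d \<longleftrightarrow> (\<exists>S h. plane_triangle S \<and> isometry_onto M d S h)"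

text \<open>\<open>(A, B, C)\<close> is an ordering of the three endpoints of \<open>(M, d)\<close>: an isometry onto a plane
  triangle carries them to its vertices. (Vertices being the extreme points, this does not
  depend on the isometry.)\<close>

definition endpoint_ordering ::
  "'e set \<Rightarrow> ('e \<Rightarrow> 'e \<Rightarrow> real) \<Rightarrow> 'e \<Rightarrow> 'e \<Rightarrow> 'e \<Rightarrow> bool" where
  "endpoint_ordering M d A B C \<longleftrightarrow>
     A \<in> M \<and> B \<in> M \<and> C \<in> M \<and>
     (\<exists>h :: 'e \<Rightarrow> real^2. \<not> collinear {h A, h B, h C} \<and>
          isometry_onto M d (convex hull {h A, h B, h C}) h)"


section \<open>Continuous families of triangles\<close>

record ('e, 'x) family =
  total :: "'e topology"
  proj  :: "'e \<Rightarrow> 'x"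
  fdist :: "'e \<Rightarrow> 'e \<Rightarrow> real"

definition fibre :: "('e, 'x) family \<Rightarrow> 'x \<Rightarrow> 'e set" where
  "fibre F x = {e \<in> topspace (total F). proj F e = x}"

text \<open>The model fibre \<open>K\<close> may be taken on the type of the total space, since over a nonempty base
  it is homeomorphic to an actual fibre.\<close>

definition fibre_bundle :: "'x topology \<Rightarrow> 'e topology \<Rightarrow> ('e \<Rightarrow> 'x) \<Rightarrow> bool" where
  "fibre_bundle X T p \<longleftrightarrow>
     continuous_map T X p \<and>
     (\<exists>K :: 'e topology. \<forall>x \<in> topspace X. \<exists>U. openin X U \<and> x \<in> U \<and>
        (\<exists>\<phi>. homeomorphic_map (subtopology T {e \<in> topspace T. p e \<in> U})
                              (prod_topology (subtopology X U) K) \<phi> \<and>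
             (\<forall>e \<in> topspace T. p e \<in> U \<longrightarrow> fst (\<phi> e) = p e)))"

definition continuous_family :: "'x topology \<Rightarrow> ('e, 'x) family \<Rightarrow> bool" where
  "continuous_family X F \<longleftrightarrow>
     continuous_map (total F) X (proj F) \<and>
     proper_map (total F) X (proj F) \<and>
     fibre_bundle X (total F) (proj F) \<and>
     continuous_map
       (subtopology (prod_topology (total F) (total F)) {(a, b). proj F a = proj F b})
       (top_of_set {0..}) (\<lambda>(a, b). fdist F a b) \<and>
     (\<forall>x \<in> topspace X. metric_on (fibre F x) (fdist F) \<and>
                       isometric_to_triangle (fibre F x) (fdist F)) \<and>
     (\<exists>A B C. (\<forall>x \<in> topspace X. endpoint_ordering (fibre F x) (fdist F) (A x) (B x) (C x)) \<and>
        continuous_map X (top_of_set {0..}) (\<lambda>x. fdist F (A x) (B x)) \<and>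
        continuous_map X (top_of_set {0..}) (\<lambda>x. fdist F (A x) (C x)) \<and>
        continuous_map X (top_of_set {0..}) (\<lambda>x. fdist F (B x) (C x)))"

definition isomorphic_families ::
  "'x topology \<Rightarrow> ('e, 'x) family \<Rightarrow> ('g, 'x) family \<Rightarrow> bool" where
  "isomorphic_families X F G \<longleftrightarrow>
     (\<exists>\<phi>. homeomorphic_map (total F) (total G) \<phi> \<and>
          (\<forall>e \<in> topspace (total F). proj G (\<phi> e) = proj F e) \<and>
          (\<forall>x \<in> topspace X. \<forall>a \<in> fibre F x. \<forall>b \<in> fibre F x.
              fdist G (\<phi> a) (\<phi> b) = fdist F a b))"

definition pullback_family ::
  "'y topology \<Rightarrow> ('y \<Rightarrow> 'x) \<Rightarrow> ('e, 'x) family \<Rightarrow> ('e \<times> 'y, 'y) family" where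
  "pullback_family Y f F =
     \<lparr> total = subtopology (prod_topology (total F) Y) {(e, y). proj F e = f y},
       proj = snd,
       fdist = (\<lambda>(a, _) (b, _). fdist F a b) \<rparr>"


section \<open>The moduli functor\<close>

text \<open>The type \<open>'u\<close> plays the role of a universe: the objects of \<open>Top\<close> are the topological spaces
  whose points lie in \<open>'u\<close> (with an arbitrary subset of \<open>'u\<close> as carrier), and isomorphism classes
  are formed among the families whose total space lies in \<open>'u\<close> as well. If \<open>'u\<close> has at least the
  cardinality of the continuum, this loses no family: a family over such a space has a total
  space of at most the cardinality of \<open>'u\<close>, hence has an isomorphic copy in \<open>'u\<close>. In particular
  this applies to pullbacks, whose class is taken among families of a different total type.\<close>

definition family_class :: "'u topology \<Rightarrow> ('e, 'u) family \<Rightarrow> ('u, 'u) family set" where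
  "family_class X F = {G. continuous_family X G \<and> isomorphic_families X F G}"

definition moduli_obj :: "'u topology \<Rightarrow> ('u, 'u) family set set" where
  "moduli_obj X = {family_class X F | F :: ('u, 'u) family. continuous_family X F}"

text \<open>All members of \<open>c\<close> yield the same class, so the union is that class.\<close>

definition moduli_map ::
  "'u topology \<Rightarrow> 'u topology \<Rightarrow> ('u \<Rightarrow> 'u) \<Rightarrow> ('u, 'u) family set \<Rightarrow> ('u, 'u) family set" where
  "moduli_map Y X f c = (\<Union>F\<in>c. family_class Y (pullback_family Y f F))"


section \<open>Fine moduli spaces\<close>

text \<open>Morphisms are made extensional so that they are determined by their values on the carrier.\<close>

definition Top_hom :: "'a topology \<Rightarrow> 'b topology \<Rightarrow> ('a \<Rightarrow> 'b) set" where
  "Top_hom X Y = {f. continuous_map X Y f} \<inter> extensional (topspace X)"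

text \<open>For a contravariant functor, given by its action on objects and on morphisms
  \<open>f : Y \<rightarrow> X\<close>.\<close>

definition natural_isomorphism_to_Hom ::
  "('u topology \<Rightarrow> 'c set) \<Rightarrow> ('u topology \<Rightarrow> 'u topology \<Rightarrow> ('u \<Rightarrow> 'u) \<Rightarrow> 'c \<Rightarrow> 'c) \<Rightarrow>
   'm topology \<Rightarrow> ('u topology \<Rightarrow> 'c \<Rightarrow> 'u \<Rightarrow> 'm) \<Rightarrow> bool" where
  "natural_isomorphism_to_Hom Fob Fmap N \<eta> \<longleftrightarrow>
     (\<forall>X. bij_betw (\<eta> X) (Fob X) (Top_hom X N)) \<and>
     (\<forall>X Y. \<forall>f \<in> Top_hom Y X. \<forall>c \<in> Fob X.
        \<eta> Y (Fmap Y X f c) = compose (topspace Y) (\<eta> X c) f)"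

definition fine_moduli_space ::
  "('u topology \<Rightarrow> 'c set) \<Rightarrow> ('u topology \<Rightarrow> 'u topology \<Rightarrow> ('u \<Rightarrow> 'u) \<Rightarrow> 'c \<Rightarrow> 'c) \<Rightarrow>
   'm topology \<Rightarrow> bool" where
  "fine_moduli_space Fob Fmap N \<longleftrightarrow> (\<exists>\<eta>. natural_isomorphism_to_Hom Fob Fmap N \<eta>)"

definition triangle_space :: "(real \<times> real \<times> real) topology" where
  "triangle_space = top_of_set {(x, y, z). 0 < x \<and> x \<le> y \<and> y \<le> z \<and> x + y > z}"

end

theory Submission
  imports Defs
begin

text \<open>
  If \<open>N\<close> were a fine moduli space, a family would be determined up to isomorphism by its
  classifying map to \<open>N\<close>. By naturality the value of that map at a point \<open>x\<close> is determined by the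
  pullback of the family to the one-point subspace \<open>{x}\<close>, hence by the isometry class of the
  fibre over \<open>x\<close> (\<open>fine_moduli_space_fibrewise\<close>). So it is enough to find two families that are
  isometric fibre by fibre but not isomorphic. They exist because triangles can have
  automorphisms, along which a family may be twisted.

  The base is the unit circle. In the first family every fibre is the equilateral triangle
  spanned by the cube roots of \<open>1\<close>; in the second the fibre over \<open>u\<close> is the triangle spanned by
  the cube roots of \<open>u\<close>. All these triangles are congruent. An isometry preserves vertices, so an
  isomorphism carries the vertex \<open>1\<close> of the first family to a continuous cube root of \<open>u\<close>
  (\<open>cube_root_if_isomorphic\<close>), and the circle has none (\<open>no_continuous_cube_root\<close>).

  That the twisted family is a continuous family rests on the existence of local cube roots, which
  give local trivialisations, and on the compactness of its total space, which gives properness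
  (\<open>continuous_family_cube_root_family\<close>). Both families are built from complex numbers and then
  carried into the universe \<open>'u\<close> along injections, which exist because \<open>'u\<close> has at least the
  cardinality of the continuum (\<open>continuous_family_push\<close>, \<open>isomorphic_families_push_cancel\<close>).
\<close>

section \<open>Isomorphisms and pullbacks of families\<close>

lemma fibre_image_isomorphism:
  assumes "homeomorphic_map (total F) (total G) \<phi>"
    and "\<And>e. e \<in> topspace (total F) \<Longrightarrow> proj G (\<phi> e) = proj F e"
  shows "\<phi> ` fibre F x = fibre G x"
proof -
  have "fibre G x = {e \<in> \<phi> ` topspace (total F). proj G e = x}"
    using homeomorphic_imp_surjective_map[OF assms(1)] by (simp add: fibre_def)
  then show ?thesis
    using assms(2) by (auto simp: fibre_def)
qed

lemma isomorphic_families_refl: "isomorphic_families X F F"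
  unfolding isomorphic_families_def by (rule exI[of _ id]) simp

lemma isomorphic_families_sym:
  assumes "isomorphic_families X F G"
  shows "isomorphic_families X G F"
proof -
  obtain \<phi> where \<phi>: "homeomorphic_map (total F) (total G) \<phi>"
      and p: "\<And>e. e \<in> topspace (total F) \<Longrightarrow> proj G (\<phi> e) = proj F e"
      and d: "\<And>x a b. x \<in> topspace X \<Longrightarrow> a \<in> fibre F x \<Longrightarrow> b \<in> fibre F x \<Longrightarrow>
                fdist G (\<phi> a) (\<phi> b) = fdist F a b"
    using assms unfolding isomorphic_families_def by blast
  obtain \<psi> where m: "homeomorphic_maps (total F) (total G) \<phi> \<psi>"
    using \<phi> homeomorphic_map_maps by blast
  then have \<psi>: "homeomorphic_map (total G) (total F) \<psi>"
    using homeomorphic_maps_map by blast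
  have inv: "\<phi> (\<psi> e) = e" "\<psi> e \<in> topspace (total F)" if "e \<in> topspace (total G)" for e
    using m that by (auto simp: homeomorphic_maps_def continuous_map_def)
  have q: "proj F (\<psi> e) = proj G e" if "e \<in> topspace (total G)" for e
    using p[OF inv(2)[OF that]] inv(1)[OF that] by simp
  have "fdist F (\<psi> a) (\<psi> b) = fdist G a b"
    if "x \<in> topspace X" "a \<in> fibre G x" "b \<in> fibre G x" for x a b
    using d[OF that(1), of "\<psi> a" "\<psi> b"] that inv q by (auto simp: fibre_def)
  then show ?thesis
    unfolding isomorphic_families_def using \<psi> q by blast
qed

lemma isomorphic_families_trans:
  assumes "isomorphic_families X F G" "isomorphic_families X G H"
  shows "isomorphic_families X F H"
proof -
  obtain \<phi> where \<phi>: "homeomorphic_map (total F) (total G) \<phi>"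
      and p: "\<And>e. e \<in> topspace (total F) \<Longrightarrow> proj G (\<phi> e) = proj F e"
      and d: "\<And>x a b. x \<in> topspace X \<Longrightarrow> a \<in> fibre F x \<Longrightarrow> b \<in> fibre F x \<Longrightarrow>
                fdist G (\<phi> a) (\<phi> b) = fdist F a b"
    using assms(1) unfolding isomorphic_families_def by blast
  obtain \<psi> where \<psi>: "homeomorphic_map (total G) (total H) \<psi>"
      and p': "\<And>e. e \<in> topspace (total G) \<Longrightarrow> proj H (\<psi> e) = proj G e"
      and d': "\<And>x a b. x \<in> topspace X \<Longrightarrow> a \<in> fibre G x \<Longrightarrow> b \<in> fibre G x \<Longrightarrow>
                fdist H (\<psi> a) (\<psi> b) = fdist G a b"
    using assms(2) unfolding isomorphic_families_def by blast
  have top: "\<phi> e \<in> topspace (total G)" if "e \<in> topspace (total F)" for e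
    using homeomorphic_imp_surjective_map[OF \<phi>] that by blast
  have fib: "\<phi> a \<in> fibre G x" if "a \<in> fibre F x" for a x
    using fibre_image_isomorphism[OF \<phi> p] that by blast
  have "homeomorphic_map (total F) (total H) (\<psi> \<circ> \<phi>)"
    using \<phi> \<psi> by (rule homeomorphic_map_compose)
  then show ?thesis
    unfolding isomorphic_families_def
    by (intro exI[of _ "\<psi> \<circ> \<phi>"]) (simp add: p p' d d' top fib)
qed

lemma family_class_cong:
  assumes "isomorphic_families X F G"
  shows "family_class X F = family_class X G"
  unfolding family_class_def
  using isomorphic_families_trans[OF assms]
    isomorphic_families_trans[OF isomorphic_families_sym[OF assms]] by blast

lemma fibre_pullback_family:
  "fibre (pullback_family Y f F) y = (if y \<in> topspace Y then fibre F (f y) \<times> {y} else {})"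
  by (auto simp: fibre_def pullback_family_def)

lemma isomorphic_pullback_family:
  assumes "f ` topspace Y \<subseteq> topspace X" and "isomorphic_families X F G"
  shows "isomorphic_families Y (pullback_family Y f F) (pullback_family Y f G)"
proof -
  obtain \<phi> where \<phi>: "homeomorphic_map (total F) (total G) \<phi>"
      and p: "\<And>e. e \<in> topspace (total F) \<Longrightarrow> proj G (\<phi> e) = proj F e"
      and d: "\<And>x a b. x \<in> topspace X \<Longrightarrow> a \<in> fibre F x \<Longrightarrow> b \<in> fibre F x \<Longrightarrow>
                fdist G (\<phi> a) (\<phi> b) = fdist F a b"
    using assms(2) unfolding isomorphic_families_def by blast
  let ?\<Phi> = "\<lambda>(e, y). (\<phi> e, y)"
  obtain \<psi> where "homeomorphic_maps (total F) (total G) \<phi> \<psi>"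
    using \<phi> homeomorphic_map_maps by blast
  then have "homeomorphic_maps (prod_topology (total F) Y) (prod_topology (total G) Y)
      ?\<Phi> (\<lambda>(e, y). (\<psi> e, y))"
    using homeomorphic_maps_prod[of "total F" Y "total G" Y \<phi> "\<lambda>y. y" \<psi> "\<lambda>y. y"]
    by (simp add: homeomorphic_maps_def)
  then have "homeomorphic_map (prod_topology (total F) Y) (prod_topology (total G) Y) ?\<Phi>"
    using homeomorphic_map_maps by blast
  then have "homeomorphic_map (total (pullback_family Y f F)) (total (pullback_family Y f G)) ?\<Phi>"
    unfolding pullback_family_def
    by simp (rule homeomorphic_map_subtopologies_alt, auto simp: p)
  then show ?thesis
    unfolding isomorphic_families_def
    apply (intro exI[of _ ?\<Phi>])
    using d assms(1) by (auto simp: fibre_pullback_family) (auto simp: pullback_family_def)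
qed

text \<open>The union in \<^const>\<open>moduli_map\<close> runs over the members of a class; since pullback preserves
  isomorphism they all contribute the same set, and the functor can be computed on any
  representative.\<close>

lemma moduli_map_family_class:
  fixes F :: "('u, 'u) family"
  assumes "f ` topspace Y \<subseteq> topspace X" and "continuous_family X F"
  shows "moduli_map Y X f (family_class X F) = family_class Y (pullback_family Y f F)"
proof -
  have "family_class Y (pullback_family Y f G) = family_class Y (pullback_family Y f F)"
    if "G \<in> family_class X F" for G
  proof -
    have "isomorphic_families X F G"
      using that by (simp add: family_class_def)
    then show ?thesis
      by (rule family_class_cong[OF isomorphic_pullback_family[OF assms(1)], symmetric])
  qed
  moreover have "F \<in> family_class X F"
    using assms(2) isomorphic_families_refl by (auto simp: family_class_def)
  ultimately show ?thesis
    unfolding moduli_map_def by blast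
qed


section \<open>A fine moduli space only sees the fibres\<close>

text \<open>Continuity of the distance map, with one argument held fixed at \<open>a\<close>, makes the metric balls
  about \<open>a\<close> open in the fibre. This is half of the comparison of the two topologies on a fibre;
  with a general \<open>h\<close> in place of the identity it also handles isometries into another fibre.\<close>

lemma fibre_isometry_continuous_map:
  assumes F: "continuous_family X F" and x: "x \<in> topspace X"
    and M: "Metric_space M m"
    and h: "h ` fibre F x \<subseteq> M"
    and iso: "\<And>a b. a \<in> fibre F x \<Longrightarrow> b \<in> fibre F x \<Longrightarrow> m (h a) (h b) = fdist F a b"
  shows "continuous_map (subtopology (total F) (fibre F x)) (Metric_space.mtopology M m) h"
proof -
  interpret Metric_space M m by (rule M)
  let ?T = "subtopology (total F) (fibre F x)"
  have top: "topspace ?T = fibre F x" by (auto simp: fibre_def)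
  show ?thesis
    unfolding continuous_map_to_metric
  proof (intro ballI allI impI)
    fix a and r :: real assume a: "a \<in> topspace ?T" and r: "r > 0"
    have "continuous_map ?T
        (subtopology (prod_topology (total F) (total F)) {(a, b). proj F a = proj F b}) (\<lambda>b. (a, b))"
      using a by (auto simp: continuous_map_in_subtopology continuous_map_pairwise o_def fibre_def
          intro: continuous_map_from_subtopology)
    moreover have "continuous_map
        (subtopology (prod_topology (total F) (total F)) {(a, b). proj F a = proj F b})
        (top_of_set {0..}) (\<lambda>(a, b). family.fdist F a b)"
      using F by (simp add: continuous_family_def)
    ultimately have "continuous_map ?T (top_of_set {0..}) (\<lambda>b. family.fdist F a b)"
      by (drule_tac continuous_map_compose) (auto simp: o_def)
    then have c: "continuous_map ?T euclideanreal (\<lambda>b. family.fdist F a b)"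
      using continuous_map_into_fulltopology by blast
    have "openin ?T {b \<in> topspace ?T. family.fdist F a b \<in> {..<r}}"
      using c by (rule openin_continuous_map_preimage) auto
    moreover have "family.fdist F a a = 0"
      using a h iso[of a a] by (auto simp: top)
    ultimately show "\<exists>U. openin ?T U \<and> a \<in> U \<and> (\<forall>b\<in>U. h b \<in> mball (h a) r)"
      using a r h iso by (intro exI[of _ "{b \<in> topspace ?T. family.fdist F a b \<in> {..<r}}"])
        (auto simp: top in_mball image_subset_iff)
  qed
qed

abbreviation fibre_dist :: "('e, 'x) family \<Rightarrow> 'x \<Rightarrow> 'e \<Rightarrow> 'e \<Rightarrow> real" where
  "fibre_dist F x \<equiv> (\<lambda>a b. if a \<in> fibre F x \<and> b \<in> fibre F x then fdist F a b else 0)"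

text \<open>The identity from a fibre with its subspace topology to the same fibre with its metric topology
  is a continuous bijection. Its source is compact because the projection is proper, and its target
  is Hausdorff, so it is a homeomorphism.\<close>

lemma fibre_metric_topology:
  assumes F: "continuous_family X F" and x: "x \<in> topspace X"
  shows "subtopology (total F) (fibre F x) = Metric_space.mtopology (fibre F x) (fibre_dist F x)"
proof -
  have M: "Metric_space (fibre F x) (fibre_dist F x)"
    using F x by (auto simp: continuous_family_def metric_on_def)
  have "compactin (total F) {e \<in> topspace (total F). proj F e \<in> {x}}"
    using F x by (intro compactin_proper_map_preimage[of _ X]) (auto simp: continuous_family_def)
  then have "compact_space (subtopology (total F) (fibre F x))"
    by (simp add: fibre_def compact_space_subtopology)
  moreover have "continuous_map (subtopology (total F) (fibre F x))
      (Metric_space.mtopology (fibre F x) (fibre_dist F x)) id"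
    using F x M by (rule fibre_isometry_continuous_map) auto
  moreover have "topspace (subtopology (total F) (fibre F x)) = fibre F x"
    by (auto simp: fibre_def)
  ultimately have "homeomorphic_map (subtopology (total F) (fibre F x))
      (Metric_space.mtopology (fibre F x) (fibre_dist F x)) id"
    by (intro continuous_imp_homeomorphic_map)
       (auto simp: Metric_space.Hausdorff_space_mtopology[OF M] Metric_space.topspace_mtopology[OF M])
  then show ?thesis by simp
qed

lemma fibre_isometry_pullback_continuous_map:
  assumes F: "continuous_family X F" and G: "continuous_family X G" and x: "x \<in> topspace X"
    and h: "h ` fibre F x \<subseteq> fibre G x"
    and iso: "\<And>a b. a \<in> fibre F x \<Longrightarrow> b \<in> fibre F x \<Longrightarrow> fdist G (h a) (h b) = fdist F a b"
    and f: "\<And>y. y \<in> topspace Y \<Longrightarrow> f y = x"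
  shows "continuous_map (total (pullback_family Y f F)) (total (pullback_family Y f G))
    (\<lambda>(e, y). (h e, y))"
proof -
  have "Metric_space (fibre G x) (fibre_dist G x)"
    using G x by (auto simp: continuous_family_def metric_on_def)
  then have "continuous_map (subtopology (total F) (fibre F x))
      (Metric_space.mtopology (fibre G x) (fibre_dist G x)) h"
    using h iso by (intro fibre_isometry_continuous_map[OF F x]) auto
  then have "continuous_map (subtopology (total F) (fibre F x)) (subtopology (total G) (fibre G x)) h"
    by (simp add: fibre_metric_topology[OF G x])
  then have c: "continuous_map (subtopology (total F) (fibre F x)) (total G) h"
    using continuous_map_into_fulltopology by blast
  have 1: "continuous_map (total (pullback_family Y f F)) (subtopology (total F) (fibre F x)) fst"
    by (auto simp: pullback_family_def continuous_map_in_subtopology fibre_def f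
        intro: continuous_map_from_subtopology continuous_map_fst)
  have "continuous_map (total (pullback_family Y f F)) (total G) (\<lambda>z. h (fst z))"
    using continuous_map_compose[OF 1 c] by (simp add: o_def)
  moreover have "continuous_map (total (pullback_family Y f F)) Y snd"
    by (auto simp: pullback_family_def intro: continuous_map_from_subtopology continuous_map_snd)
  ultimately have "continuous_map (total (pullback_family Y f F)) (prod_topology (total G) Y)
      (\<lambda>z. (h (fst z), snd z))"
    by (simp add: continuous_map_pairwise o_def)
  moreover have "proj G (h a) = x" if "a \<in> topspace (total F)" "proj F a = x" for a
    using that h by (auto simp: fibre_def)
  ultimately show ?thesis
    by (auto simp: pullback_family_def continuous_map_in_subtopology case_prod_unfold f)
qed

text \<open>Over a constant map the pullbacks are products with the fibre over \<open>x\<close>. Both fibres over \<open>x\<close>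
  carry their metric topologies, so a distance-preserving bijection between them is automatically a
  homeomorphism.\<close>

lemma isometric_fibres_imp_isomorphic_pullbacks:
  assumes F: "continuous_family X F" and G: "continuous_family X G" and x: "x \<in> topspace X"
    and h: "bij_betw h (fibre F x) (fibre G x)"
    and iso: "\<And>a b. a \<in> fibre F x \<Longrightarrow> b \<in> fibre F x \<Longrightarrow> fdist G (h a) (h b) = fdist F a b"
    and f: "\<And>y. y \<in> topspace Y \<Longrightarrow> f y = x"
  shows "isomorphic_families Y (pullback_family Y f F) (pullback_family Y f G)"
proof -
  define k where "k = inv_into (fibre F x) h"
  have hk: "h (k b) = b" "k b \<in> fibre F x" if "b \<in> fibre G x" for b
    using that h unfolding k_def
    by (auto simp: bij_betw_def f_inv_into_f inv_into_into)
  have kh: "k (h a) = a" "h a \<in> fibre G x" if "a \<in> fibre F x" for a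
    using that h unfolding k_def by (auto simp: bij_betw_def)
  have isok: "fdist F (k a) (k b) = fdist G a b" if "a \<in> fibre G x" "b \<in> fibre G x" for a b
    using iso[of "k a" "k b"] hk that by simp
  have "homeomorphic_maps (total (pullback_family Y f F)) (total (pullback_family Y f G))
      (\<lambda>(e, y). (h e, y)) (\<lambda>(e, y). (k e, y))"
    unfolding homeomorphic_maps_def
  proof (intro conjI)
    show "continuous_map (total (pullback_family Y f F)) (total (pullback_family Y f G))
        (\<lambda>(e, y). (h e, y))"
      using kh iso f by (intro fibre_isometry_pullback_continuous_map[OF F G x]) auto
    show "continuous_map (total (pullback_family Y f G)) (total (pullback_family Y f F))
        (\<lambda>(e, y). (k e, y))"
      using hk isok f by (intro fibre_isometry_pullback_continuous_map[OF G F x]) auto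
  qed (auto simp: pullback_family_def f hk kh fibre_def)
  then have "homeomorphic_map (total (pullback_family Y f F)) (total (pullback_family Y f G))
      (\<lambda>(e, y). (h e, y))"
    using homeomorphic_map_maps by blast
  then show ?thesis
    unfolding isomorphic_families_def
    apply (intro exI[of _ "\<lambda>(e, y). (h e, y)"])
    using iso by (auto simp: fibre_pullback_family f) (auto simp: pullback_family_def)
qed

text \<open>Naturality at the inclusion of a point \<open>x\<close> says that the map to \<open>N\<close> classifying a family
  takes at \<open>x\<close> a value depending on the isometry class of the fibre over \<open>x\<close> alone. So two
  fibrewise isometric families have the same classifying map, and injectivity of \<open>\<eta>\<close> on classes
  makes them isomorphic.\<close>

lemma fine_moduli_space_fibrewise:
  fixes X :: "'u topology" and F G :: "('u, 'u) family"
  assumes fine: "fine_moduli_space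
        (moduli_obj :: 'u topology \<Rightarrow> ('u, 'u) family set set) moduli_map N"
    and F: "continuous_family X F" and G: "continuous_family X G"
    and iso: "\<And>x. x \<in> topspace X \<Longrightarrow> \<exists>h. bij_betw h (fibre F x) (fibre G x) \<and>
           (\<forall>a\<in>fibre F x. \<forall>b\<in>fibre F x. fdist G (h a) (h b) = fdist F a b)"
  shows "isomorphic_families X F G"
proof -
  obtain \<eta> where bij: "\<And>X :: 'u topology. bij_betw (\<eta> X) (moduli_obj X) (Top_hom X N)"
    and nat: "\<And>(X :: 'u topology) Y f c. f \<in> Top_hom Y X \<Longrightarrow> c \<in> moduli_obj X \<Longrightarrow>
        \<eta> Y (moduli_map Y X f c) = compose (topspace Y) (\<eta> X c) f"
    using fine unfolding fine_moduli_space_def natural_isomorphism_to_Hom_def by blast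
  let ?c = "family_class X F" and ?c' = "family_class X G"
  have c: "?c \<in> moduli_obj X" "?c' \<in> moduli_obj X"
    using F G by (auto simp: moduli_obj_def)
  have "\<eta> X ?c x = \<eta> X ?c' x" if x: "x \<in> topspace X" for x
  proof -
    define P where "P = subtopology X {x}"
    define f where "f = (\<lambda>y\<in>topspace P. x)"
    have P: "topspace P = {x}" using x by (auto simp: P_def)
    have f: "f \<in> Top_hom P X"
      unfolding Top_hom_def f_def using x
      by (auto intro: continuous_map_eq[where f = "\<lambda>_. x"])
    have fx: "f ` topspace P \<subseteq> topspace X" "f x = x"
      using x by (auto simp: f_def P)
    obtain h where h: "bij_betw h (fibre F x) (fibre G x)"
        "\<forall>a\<in>fibre F x. \<forall>b\<in>fibre F x. fdist G (h a) (h b) = fdist F a b"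
      using iso[OF x] by blast
    have "isomorphic_families P (pullback_family P f F) (pullback_family P f G)"
      using h fx(2) by (intro isometric_fibres_imp_isomorphic_pullbacks[OF F G x h(1)]) (auto simp: P)
    then have "moduli_map P X f ?c = moduli_map P X f ?c'"
      by (simp add: moduli_map_family_class[OF fx(1)] F G family_class_cong)
    then have "compose (topspace P) (\<eta> X ?c) f x = compose (topspace P) (\<eta> X ?c') f x"
      using nat[OF f] c by metis
    then show ?thesis
      by (simp add: compose_def P fx(2))
  qed
  moreover have "\<eta> X ?c \<in> extensional (topspace X)" "\<eta> X ?c' \<in> extensional (topspace X)"
    using bij[of X] c by (auto simp: bij_betw_def Top_hom_def)
  ultimately have "\<eta> X ?c = \<eta> X ?c'"
    by (intro extensionalityI[of _ "topspace X"]) auto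
  then have "?c = ?c'"
    using bij[of X] c by (auto simp: bij_betw_def inj_on_def)
  moreover have "G \<in> ?c'"
    using G isomorphic_families_refl by (auto simp: family_class_def)
  ultimately show ?thesis
    by (auto simp: family_class_def)
qed


section \<open>Moving a family to another type\<close>

text \<open>The topology on the image of an injection \<open>k\<close> that makes \<open>k\<close> a homeomorphism onto its image,
  obtained by pulling back along the inverse of \<open>k\<close>. Families built from complex numbers are moved
  into the universe \<open>'u\<close> in this way.\<close>

definition push_topology :: "('a \<Rightarrow> 'b) \<Rightarrow> 'a topology \<Rightarrow> 'b topology" where
  "push_topology k T = pullback_topology (k ` topspace T) (inv k) T"

lemma homeomorphic_maps_push_topology:
  assumes "inj k"
  shows "homeomorphic_maps T (push_topology k T) k (inv k)"
proof -
  have "continuous_map (push_topology k T) T (id \<circ> inv k)"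
    unfolding push_topology_def by (rule continuous_map_pullback) simp
  moreover have "continuous_map T (push_topology k T) k"
    unfolding push_topology_def by (rule continuous_map_pullback') (auto simp: assms o_def)
  moreover have "topspace (push_topology k T) = k ` topspace T"
    using assms by (auto simp: push_topology_def topspace_pullback_topology)
  ultimately show ?thesis
    using assms by (auto simp: homeomorphic_maps_def)
qed

lemma topspace_push_topology: "inj k \<Longrightarrow> topspace (push_topology k T) = k ` topspace T"
  by (auto simp: push_topology_def topspace_pullback_topology)

definition push_family :: "('x \<Rightarrow> 'y) \<Rightarrow> ('e \<Rightarrow> 'g) \<Rightarrow> ('e, 'x) family \<Rightarrow> ('g, 'y) family" where
  "push_family i k F =
     \<lparr> total = push_topology k (total F),
       proj = i \<circ> proj F \<circ> inv k,
       fdist = (\<lambda>a b. fdist F (inv k a) (inv k b)) \<rparr>"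

lemma fibre_push_family:
  assumes "inj i" "inj k"
  shows "fibre (push_family i k F) (i x) = k ` fibre F x"
  using assms by (auto simp: fibre_def push_family_def topspace_push_topology inj_eq)

lemma fdist_push_family:
  "inj k \<Longrightarrow> fdist (push_family i k F) (k a) (k b) = fdist F a b"
  by (simp add: push_family_def)

lemma metric_on_image:
  assumes "inj k" and d: "\<And>a b. d' (k a) (k b) = d a b" and "metric_on M d"
  shows "metric_on (k ` M) d'"
proof -
  interpret Metric_space M "\<lambda>a b. if a \<in> M \<and> b \<in> M then d a b else 0"
    using assms(3) by (simp add: metric_on_def)
  have *: "0 \<le> d a b" "d a b = d b a" "d a b = 0 \<longleftrightarrow> a = b" if "a \<in> M" "b \<in> M" for a b
    using nonneg[of a b] commute[of a b] zero[of a b] that by auto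
  have **: "d a c \<le> d a b + d b c" if "a \<in> M" "b \<in> M" "c \<in> M" for a b c
    using triangle[of a b c] that by simp
  show ?thesis
    unfolding metric_on_def
    by unfold_locales (use * ** \<open>inj k\<close> in \<open>auto simp: d inj_eq\<close>)
qed

lemma endpoint_ordering_image:
  assumes "inj k" and d: "\<And>a b. d' (k a) (k b) = d a b" and "endpoint_ordering M d A B C"
  shows "endpoint_ordering (k ` M) d' (k A) (k B) (k C)"
proof -
  obtain h :: "'a \<Rightarrow> real^2" where h: "\<not> collinear {h A, h B, h C}"
      "isometry_onto M d (convex hull {h A, h B, h C}) h"
    using assms(3) by (auto simp: endpoint_ordering_def)
  let ?h = "h \<circ> inv k"
  have "bij_betw (inv k) (k ` M) M"
    using \<open>inj k\<close> by (auto simp: bij_betw_def inj_on_def image_comp)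
  then have "isometry_onto (k ` M) d' (convex hull {h A, h B, h C}) ?h"
    using h(2) \<open>inj k\<close> by (auto simp: isometry_onto_def d intro: bij_betw_trans)
  then show ?thesis
    using assms(3) h(1) \<open>inj k\<close> unfolding endpoint_ordering_def
    by (intro conjI exI[of _ ?h]) auto
qed

lemma isometric_to_triangle_image:
  assumes "inj k" and d: "\<And>a b. d' (k a) (k b) = d a b" and "isometric_to_triangle M d"
  shows "isometric_to_triangle (k ` M) d'"
proof -
  obtain S and h :: "'a \<Rightarrow> real^2" where S: "plane_triangle S" and h: "isometry_onto M d S h"
    using assms(3) by (auto simp: isometric_to_triangle_def)
  have "bij_betw (inv k) (k ` M) M"
    using \<open>inj k\<close> by (auto simp: bij_betw_def inj_on_def image_comp)
  then have "isometry_onto (k ` M) d' S (h \<circ> inv k)"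
    using h \<open>inj k\<close> by (auto simp: isometry_onto_def d intro: bij_betw_trans)
  with S show ?thesis
    by (auto simp: isometric_to_triangle_def)
qed

lemma fibre_bundle_push:
  fixes X :: "'x topology" and T :: "'e topology"
  assumes "inj i" "inj k" and "fibre_bundle X T p"
  shows "fibre_bundle (push_topology i X) (push_topology k T) (i \<circ> p \<circ> inv k)"
proof -
  note mi = homeomorphic_maps_push_topology[OF \<open>inj i\<close>]
  note mk = homeomorphic_maps_push_topology[OF \<open>inj k\<close>]
  have p: "continuous_map T X p" using assms(3) by (simp add: fibre_bundle_def)
  from assms(3)[unfolded fibre_bundle_def, THEN conjunct2] obtain K :: "'e topology" where K: "\<forall>x\<in>topspace X. \<exists>U. openin X U \<and> x \<in> U \<and>
        (\<exists>\<phi>. homeomorphic_map (subtopology T {e \<in> topspace T. p e \<in> U})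
                              (prod_topology (subtopology X U) K) \<phi> \<and>
             (\<forall>e \<in> topspace T. p e \<in> U \<longrightarrow> fst (\<phi> e) = p e))"
    by (rule exE)
  have "\<exists>U'. openin (push_topology i X) U' \<and> x' \<in> U' \<and>
        (\<exists>\<phi>'. homeomorphic_map
             (subtopology (push_topology k T)
                {e \<in> topspace (push_topology k T). (i \<circ> p \<circ> inv k) e \<in> U'})
             (prod_topology (subtopology (push_topology i X) U') (push_topology k K)) \<phi>' \<and>
             (\<forall>e \<in> topspace (push_topology k T). (i \<circ> p \<circ> inv k) e \<in> U' \<longrightarrow>
                fst (\<phi>' e) = (i \<circ> p \<circ> inv k) e))"
    if x': "x' \<in> topspace (push_topology i X)" for x'
  proof -
    obtain x where x: "x \<in> topspace X" "x' = i x"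
      using x' \<open>inj i\<close> by (auto simp: topspace_push_topology)
    from bspec[OF K x(1)] obtain U \<phi> where U: "openin X U" "x \<in> U"
      and \<phi>: "homeomorphic_map (subtopology T {e \<in> topspace T. p e \<in> U})
                              (prod_topology (subtopology X U) K) \<phi>"
      and fst: "\<forall>e \<in> topspace T. p e \<in> U \<longrightarrow> fst (\<phi> e) = p e"
      by (elim exE conjE) (rule that)
    define V where "V = {e \<in> topspace T. p e \<in> U}"
    have V: "{e \<in> topspace (push_topology k T). (i \<circ> p \<circ> inv k) e \<in> i ` U} = k ` V"
      using \<open>inj i\<close> \<open>inj k\<close> by (auto simp: V_def topspace_push_topology inj_image_mem_iff)
    have "homeomorphic_maps (subtopology T V) (subtopology (push_topology k T) (k ` V)) k (inv k)"
      using \<open>inj k\<close>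
      by (intro homeomorphic_maps_subtopologies[OF mk])
         (simp add: topspace_push_topology image_Int)
    then have 1: "homeomorphic_map (subtopology (push_topology k T) (k ` V)) (subtopology T V) (inv k)"
      by (rule homeomorphic_maps_imp_map[OF homeomorphic_maps_sym[THEN iffD1]])
    have "homeomorphic_maps (subtopology X U) (subtopology (push_topology i X) (i ` U)) i (inv i)"
      using \<open>inj i\<close>
      by (intro homeomorphic_maps_subtopologies[OF mi]) (simp add: topspace_push_topology image_Int)
    then have "homeomorphic_maps (prod_topology (subtopology X U) K)
        (prod_topology (subtopology (push_topology i X) (i ` U)) (push_topology k K))
        (\<lambda>(u, v). (i u, k v)) (\<lambda>(u, v). (inv i u, inv k v))"
      using homeomorphic_maps_push_topology[OF \<open>inj k\<close>, of K]
      by (simp add: homeomorphic_maps_prod)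
    then have 2: "homeomorphic_map (prod_topology (subtopology X U) K)
        (prod_topology (subtopology (push_topology i X) (i ` U)) (push_topology k K))
        (\<lambda>(u, v). (i u, k v))"
      by (rule homeomorphic_maps_imp_map)
    have "homeomorphic_map (subtopology (push_topology k T) (k ` V))
        (prod_topology (subtopology (push_topology i X) (i ` U)) (push_topology k K))
        ((\<lambda>(u, v). (i u, k v)) \<circ> (\<phi> \<circ> inv k))"
      using homeomorphic_map_compose[OF homeomorphic_map_compose[OF 1 \<phi>[folded V_def]] 2] .
    moreover have "openin (push_topology i X) (i ` U)"
      using homeomorphic_imp_open_map[OF homeomorphic_maps_imp_map[OF mi]] U(1)
      by (simp add: open_map_def)
    moreover have "fst (((\<lambda>(u, v). (i u, k v)) \<circ> (\<phi> \<circ> inv k)) e) = (i \<circ> p \<circ> inv k) e"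
      if "e \<in> topspace (push_topology k T)" "(i \<circ> p \<circ> inv k) e \<in> i ` U" for e
      using that fst \<open>inj i\<close> \<open>inj k\<close>
      by (auto simp: topspace_push_topology inj_image_mem_iff case_prod_unfold)
    ultimately show ?thesis
      unfolding V[symmetric] using U(2) x(2)
      by (intro exI[of _ "i ` U"] conjI exI[of _ "(\<lambda>(u, v). (i u, k v)) \<circ> (\<phi> \<circ> inv k)"] ballI impI)
         auto
  qed
  moreover have "continuous_map (push_topology k T) (push_topology i X) (i \<circ> p \<circ> inv k)"
    using mi[of X] mk[of T] p unfolding homeomorphic_maps_def
    by (intro continuous_map_compose[of _ T] continuous_map_compose[of _ X]) auto
  ultimately show ?thesis
    unfolding fibre_bundle_def by (intro conjI exI[of _ "push_topology k K"] ballI)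
qed

lemma continuous_family_push:
  assumes "inj i" "inj k" and F: "continuous_family X F"
  shows "continuous_family (push_topology i X) (push_family i k F)"
proof -
  note mi = homeomorphic_maps_push_topology[OF \<open>inj i\<close>]
  note mk = homeomorphic_maps_push_topology[OF \<open>inj k\<close>]
  let ?X = "push_topology i X" and ?F = "push_family i k F"
  have c: "continuous_map ?X X (inv i)" "continuous_map (push_topology k (total F)) (total F) (inv k)"
    using mi mk by (auto simp: homeomorphic_maps_def)
  have top: "topspace ?X = i ` topspace X"
    using \<open>inj i\<close> by (rule topspace_push_topology)
  have fib: "fibre ?F (i x) = k ` fibre F x" for x
    by (simp add: fibre_push_family assms)
  have d: "fdist ?F (k a) (k b) = fdist F a b" for a b
    by (simp add: fdist_push_family assms)
  have fb: "fibre_bundle ?X (total ?F) (proj ?F)"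
    using F fibre_bundle_push[OF assms(1,2)] by (simp add: continuous_family_def push_family_def)
  have proper: "proper_map (total ?F) ?X (proj ?F)"
  proof -
    have "proper_map X ?X i" "proper_map (push_topology k (total F)) (total F) (inv k)"
      using mi mk homeomorphic_maps_imp_map homeomorphic_maps_sym homeomorphic_imp_proper_map by metis+
    moreover have "proper_map (total F) X (proj F)"
      using F by (simp add: continuous_family_def)
    ultimately have "proper_map (push_topology k (total F)) ?X (i \<circ> proj F \<circ> inv k)"
      by (metis proper_map_compose)
    then show ?thesis
      by (simp add: push_family_def)
  qed
  have dist: "continuous_map
       (subtopology (prod_topology (total ?F) (total ?F)) {(a, b). proj ?F a = proj ?F b})
       (top_of_set {0..}) (\<lambda>(a, b). fdist ?F a b)"
  proof -
    let ?S = "subtopology (prod_topology (total ?F) (total ?F)) {(a, b). proj ?F a = proj ?F b}"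
    have "continuous_map ?S (total F) (inv k \<circ> fst)" "continuous_map ?S (total F) (inv k \<circ> snd)"
      by (rule continuous_map_compose[OF _ c(2)],
          simp add: push_family_def continuous_map_from_subtopology continuous_map_fst continuous_map_snd)+
    then have "continuous_map ?S
        (subtopology (prod_topology (total F) (total F)) {(a, b). proj F a = proj F b})
        (\<lambda>z. (inv k (fst z), inv k (snd z)))"
      using \<open>inj i\<close>
      by (auto simp: continuous_map_in_subtopology continuous_map_pairwise o_def push_family_def inj_eq)
    moreover have "continuous_map
       (subtopology (prod_topology (total F) (total F)) {(a, b). proj F a = proj F b})
       (top_of_set {0..}) (\<lambda>(a, b). fdist F a b)"
      using F by (simp add: continuous_family_def)
    ultimately have "continuous_map ?S (top_of_set {0..})
        ((\<lambda>(a, b). fdist F a b) \<circ> (\<lambda>z. (inv k (fst z), inv k (snd z))))"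
      by (rule continuous_map_compose)
    then show ?thesis
      by (simp add: o_def case_prod_unfold push_family_def)
  qed
  obtain A B C where
    ABC: "\<And>x. x \<in> topspace X \<Longrightarrow> endpoint_ordering (fibre F x) (fdist F) (A x) (B x) (C x)"
    and cont: "continuous_map X (top_of_set {0..}) (\<lambda>x. fdist F (A x) (B x))"
        "continuous_map X (top_of_set {0..}) (\<lambda>x. fdist F (A x) (C x))"
        "continuous_map X (top_of_set {0..}) (\<lambda>x. fdist F (B x) (C x))"
    using F unfolding continuous_family_def by blast
  have "endpoint_ordering (fibre ?F x') (fdist ?F)
      ((k \<circ> A \<circ> inv i) x') ((k \<circ> B \<circ> inv i) x') ((k \<circ> C \<circ> inv i) x')"
    if "x' \<in> topspace ?X" for x'
    using that ABC \<open>inj i\<close> by (auto simp: top fib intro!: endpoint_ordering_image[where d = "fdist F", OF \<open>inj k\<close> d])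
  moreover have
    "continuous_map ?X (top_of_set {0..}) (\<lambda>x. fdist ?F ((k \<circ> A \<circ> inv i) x) ((k \<circ> B \<circ> inv i) x))"
    "continuous_map ?X (top_of_set {0..}) (\<lambda>x. fdist ?F ((k \<circ> A \<circ> inv i) x) ((k \<circ> C \<circ> inv i) x))"
    "continuous_map ?X (top_of_set {0..}) (\<lambda>x. fdist ?F ((k \<circ> B \<circ> inv i) x) ((k \<circ> C \<circ> inv i) x))"
    using cont[THEN continuous_map_compose[OF c(1)]] by (simp_all add: d o_def)
  moreover have "metric_on (fibre ?F x') (fdist ?F)" "isometric_to_triangle (fibre ?F x') (fdist ?F)"
    if "x' \<in> topspace ?X" for x'
    using that F unfolding continuous_family_def
    by (auto simp: top fib intro!: metric_on_image[where d = "fdist F", OF \<open>inj k\<close> d]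
        isometric_to_triangle_image[where d = "fdist F", OF \<open>inj k\<close> d])
  ultimately show ?thesis
    using fb proper dist unfolding continuous_family_def
    by (intro conjI exI[of _ "k \<circ> A \<circ> inv i"] exI[of _ "k \<circ> B \<circ> inv i"] exI[of _ "k \<circ> C \<circ> inv i"]
          ballI) (auto simp only: fibre_bundle_def)
qed

lemma isomorphic_families_push_cancel:
  assumes "inj i" "inj k"
    and "isomorphic_families (push_topology i X) (push_family i k F) (push_family i k G)"
  shows "isomorphic_families X F G"
proof -
  obtain \<phi> where \<phi>: "homeomorphic_map (push_topology k (total F)) (push_topology k (total G)) \<phi>"
      and p: "\<And>e. e \<in> topspace (push_topology k (total F)) \<Longrightarrow>
            proj (push_family i k G) (\<phi> e) = proj (push_family i k F) e"
      and d: "\<And>x a b. x \<in> topspace (push_topology i X) \<Longrightarrow>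
            a \<in> fibre (push_family i k F) x \<Longrightarrow> b \<in> fibre (push_family i k F) x \<Longrightarrow>
                fdist (push_family i k G) (\<phi> a) (\<phi> b) = fdist (push_family i k F) a b"
    using assms(3) unfolding isomorphic_families_def by (auto simp: push_family_def)
  note mk = homeomorphic_maps_push_topology[OF \<open>inj k\<close>]
  have "homeomorphic_map (total F) (total G) (inv k \<circ> (\<phi> \<circ> k))"
    using homeomorphic_map_compose[OF homeomorphic_map_compose[OF
        homeomorphic_maps_imp_map[OF mk] \<phi>] homeomorphic_maps_imp_map[OF mk[THEN homeomorphic_maps_sym[THEN iffD1]]]]
    by (simp add: o_assoc)
  moreover have "proj G ((inv k \<circ> (\<phi> \<circ> k)) e) = proj F e" if "e \<in> topspace (total F)" for e
    using p[of "k e"] that assms(1,2) by (auto simp: topspace_push_topology push_family_def inj_eq)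
  moreover have "fdist G ((inv k \<circ> (\<phi> \<circ> k)) a) ((inv k \<circ> (\<phi> \<circ> k)) b) = fdist F a b"
    if "x \<in> topspace X" "a \<in> fibre F x" "b \<in> fibre F x" for x a b
    using d[of "i x" "k a" "k b"] that assms(1,2)
    by (auto simp: topspace_push_topology fibre_push_family) (simp add: push_family_def)
  ultimately show ?thesis
    unfolding isomorphic_families_def by blast
qed

lemma inj_Pair_self:
  assumes "infinite (UNIV :: 'u set)"
  shows "\<exists>f :: 'u \<times> 'u \<Rightarrow> 'u. inj f"
proof -
  obtain f where "bij_betw f (UNIV \<times> UNIV :: ('u \<times> 'u) set) (UNIV :: 'u set)"
    using card_of_Times_same_infinite[OF assms] card_of_ordIso by metis
  then show ?thesis
    by (auto simp: bij_betw_def)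
qed

text \<open>A pair of complex numbers is four reals, which repeated pairing encodes into one.\<close>

lemma inj_complex:
  assumes "inj (\<iota> :: real \<Rightarrow> 'u)"
  shows "\<exists>i :: complex \<Rightarrow> 'u. inj i" and "\<exists>k :: complex \<times> complex \<Rightarrow> 'u. inj k"
proof -
  obtain q :: "real \<times> real \<Rightarrow> real" where q: "inj q"
    using inj_Pair_self[OF infinite_UNIV_char_0] by metis
  have j: "inj (\<lambda>z. q (Re z, Im z))"
    by (rule injI) (simp add: inj_eq[OF q] complex_eq_iff)
  show "\<exists>i :: complex \<Rightarrow> 'u. inj i"
    using inj_compose[OF assms j] by (intro exI)
  have "inj (\<lambda>(z, w). \<iota> (q (q (Re z, Im z), q (Re w, Im w))))"
    by (rule injI) (auto simp: inj_eq[OF q] inj_eq[OF assms] complex_eq_iff)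
  then show "\<exists>k :: complex \<times> complex \<Rightarrow> 'u. inj k" by (intro exI)
qed


section \<open>The triangle of cube roots\<close>

definition root3 :: complex where
  "root3 = Complex (- 1 / 2) (sqrt 3 / 2)"

lemma root3: "root3\<^sup>2 = - 1 - root3" "root3 ^ 3 = 1" "norm root3 = 1"
proof -
  show sq: "root3\<^sup>2 = - 1 - root3"
    by (simp add: root3_def complex_eq_iff power2_eq_square field_simps)
  then show "root3 ^ 3 = 1" by algebra
  show "norm root3 = 1"
    by (simp add: root3_def cmod_def power2_eq_square field_simps)
qed

lemma norm_root3_diffs: "norm (1 - root3) = sqrt 3" "norm (1 - root3\<^sup>2) = sqrt 3"
  "norm (root3 - root3\<^sup>2) = sqrt 3"
  unfolding root3(1) by (simp_all add: root3_def cmod_def power2_eq_square field_simps)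

lemma dist_mult_unit:
  fixes r :: complex
  assumes "norm r = 1"
  shows "dist (r * a) (r * b) = dist a b"
  using assms by (simp add: dist_norm norm_mult flip: right_diff_distrib)

lemma dist_cube_roots:
  assumes "norm r = 1"
  shows "dist r (r * root3) = sqrt 3" "dist r (r * root3\<^sup>2) = sqrt 3"
    "dist (r * root3) (r * root3\<^sup>2) = sqrt 3"
  using dist_mult_unit[OF assms, of 1 root3] dist_mult_unit[OF assms, of 1 "root3\<^sup>2"]
    dist_mult_unit[OF assms, of root3 "root3\<^sup>2"]
  by (simp_all add: dist_norm norm_root3_diffs)

lemma cube_roots_eq: "{z. z ^ 3 = r ^ 3} = {r, r * root3, r * root3\<^sup>2}"
proof -
  have *: "z ^ 3 - r ^ 3 = (z - r) * (z - r * root3) * (z - r * root3\<^sup>2)" for z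
    using root3(1) by algebra
  have "z ^ 3 = r ^ 3 \<longleftrightarrow> z = r \<or> z = r * root3 \<or> z = r * root3\<^sup>2" for z
    using *[of z] by (metis (no_types, opaque_lifting) eq_iff_diff_eq_0 mult_eq_0_iff)
  then show ?thesis by auto
qed

text \<open>For \<open>norm c = 1\<close> an equilateral triangle inscribed in the unit circle. It depends only on \<open>c\<close>,
  whereas naming one of its vertices amounts to choosing a cube root of \<open>c\<close>.\<close>

definition triangle_of :: "complex \<Rightarrow> complex set" where
  "triangle_of c = convex hull {z. z ^ 3 = c}"

lemma triangle_of_cube: "triangle_of (r ^ 3) = convex hull {r, r * root3, r * root3\<^sup>2}"
  by (simp add: triangle_of_def cube_roots_eq)

lemma triangle_of_mult: "triangle_of (r ^ 3 * s ^ 3) = (*) r ` triangle_of (s ^ 3)"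
proof -
  have "linear ((*) r)"
    by (simp add: linear_iff algebra_simps)
  then show ?thesis
    unfolding power_mult_distrib[symmetric] triangle_of_cube
    by (simp add: convex_hull_linear_image mult.assoc)
qed

lemma norm_eq_1_if_cube:
  fixes z :: complex
  assumes "norm (z ^ 3) = 1"
  shows "norm z = 1"
  using power_eq_1_iff[of "norm z" 3] assms by (simp add: norm_power)

lemma cube_root_exists:
  assumes "norm c = 1"
  obtains r :: complex where "r ^ 3 = c" "norm r = 1"
proof -
  have "c \<noteq> 0" using assms by auto
  then have "exp (Ln c / 3) ^ 3 = c"
    by (simp flip: exp_of_nat_mult)
  with assms that[of "exp (Ln c / 3)"] show ?thesis
    by (simp only: norm_eq_1_if_cube)
qed

lemma norm_triangle_of_le:
  assumes "norm c = 1" "z \<in> triangle_of c"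
  shows "norm z \<le> 1"
proof -
  have "{z. z ^ 3 = c} \<subseteq> cball 0 1"
  proof
    fix z assume "z \<in> {z. z ^ 3 = c}"
    then have "norm z = 1" using assms(1) norm_eq_1_if_cube[of z] by auto
    then show "z \<in> cball 0 1" by simp
  qed
  then have "triangle_of c \<subseteq> cball 0 1"
    unfolding triangle_of_def by (intro hull_minimal) auto
  with assms(2) show ?thesis by auto
qed

text \<open>The unit disc is strictly convex: a unit vector \<open>z\<close> is the only point \<open>w\<close> of the disc with
  \<open>inner z w \<ge> 1\<close>. If \<open>z\<close> were not among the three cube roots, all of them and hence their hull
  would lie in the half plane \<open>inner z w < 1\<close>, which does not contain \<open>z\<close>. Together with the next
  lemma this recognises the vertices of the triangle by distances alone.\<close>

lemma unit_point_of_triangle: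
  assumes c: "norm c = 1" and z: "z \<in> triangle_of c" "norm z = 1"
  shows "z ^ 3 = c"
proof (rule ccontr)
  assume n: "z ^ 3 \<noteq> c"
  have "{w. w ^ 3 = c} \<subseteq> {w. inner z w < 1}"
  proof
    fix w assume w: "w \<in> {w. w ^ 3 = c}"
    have "w \<in> triangle_of c"
      using w hull_subset unfolding triangle_of_def by fast
    then have "norm w \<le> 1" by (rule norm_triangle_of_le[OF c])
    then have "norm w ^ 2 \<le> 1" by (simp add: power_le_one)
    moreover have "0 < norm (z - w) ^ 2"
      using w n by auto
    moreover have "norm (z - w) ^ 2 = 1 - 2 * inner z w + norm w ^ 2"
      using z(2) by (simp add: power2_norm_eq_inner inner_diff inner_commute algebra_simps flip: norm_eq_1)
    ultimately show "w \<in> {w. inner z w < 1}" by simp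
  qed
  then have "triangle_of c \<subseteq> {w. inner z w < 1}"
    unfolding triangle_of_def by (intro hull_minimal convex_halfspace_lt) auto
  with z show False by (auto simp: norm_eq_1)
qed

text \<open>The identity \<open>|x + y + z|\<^sup>2 + |x - y|\<^sup>2 + |x - z|\<^sup>2 + |y - z|\<^sup>2 = 3 (|x|\<^sup>2 + |y|\<^sup>2 + |z|\<^sup>2)\<close>
  forces the three norms to be as large as the disc permits.\<close>

lemma far_points_in_disc:
  fixes x y z :: complex
  assumes "norm x \<le> 1" "norm y \<le> 1" "norm z \<le> 1"
    and "dist x y = sqrt 3" "dist x z = sqrt 3" "dist y z = sqrt 3"
  shows "norm x = 1"
proof -
  have "norm (x + y + z) ^ 2 + (dist x y ^ 2 + dist x z ^ 2 + dist y z ^ 2)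
      = 3 * (norm x ^ 2 + norm y ^ 2 + norm z ^ 2)"
    unfolding dist_norm power2_norm_eq_inner
    by (simp add: inner_diff inner_add inner_commute algebra_simps)
  moreover have "norm y ^ 2 \<le> 1" "norm z ^ 2 \<le> 1"
    using assms by (simp_all add: power_le_one)
  moreover have "sqrt 3 ^ 2 = (3 :: real)" "0 \<le> norm (x + y + z) ^ 2"
    by simp_all
  ultimately have "3 * 1 \<le> 3 * norm x ^ 2"
    unfolding assms(4-6) distrib_left by linarith
  then have "1 \<le> norm x"
    using power2_le_imp_le[of 1 "norm x"] by simp
  then show ?thesis
    using assms(1) by simp
qed

text \<open>The circle has no continuous cube root: dividing \<open>s (cis t)\<close> by \<open>cis (t / 3)\<close> would give a
  continuous, hence constant, third root of unity on \<open>{0..2 * pi}\<close>, but its values at the two ends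
  differ by the factor \<open>cis (2 * pi / 3)\<close>.\<close>

lemma no_continuous_cube_root:
  assumes "continuous_on (sphere 0 1) s" and s: "\<And>u. norm u = 1 \<Longrightarrow> s u ^ 3 = (u :: complex)"
  shows False
proof -
  define q where "q t = s (cis t) * cis (- (t / 3))" for t :: real
  have "continuous_on {0..2 * pi} (\<lambda>t. s (cis t))"
    by (rule continuous_on_compose2[OF assms(1)]) (auto intro!: continuous_intros)
  then have c: "continuous_on {0..2 * pi} q"
    unfolding q_def by (auto intro!: continuous_intros)
  have "q t ^ 3 = 1" for t
    by (simp add: q_def power_mult_distrib s Complex.DeMoivre cis_mult)
  then have "q ` {0..2 * pi} \<subseteq> {z. z ^ 3 = 1}" by auto
  then have "finite (q ` {0..2 * pi})"
    by (rule finite_subset) (rule finite_roots_unity, simp)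
  then have "q constant_on {0..2 * pi}"
    using c by (intro continuous_finite_range_constant) auto
  then have "q 0 = q (2 * pi)"
    by (auto simp: constant_on_def)
  moreover have "s 1 \<noteq> 0" using s[of 1] by auto
  ultimately have "cis (- (2 * pi / 3)) = 1"
    by (simp add: q_def)
  then have "sin (2 * pi / 3) = 0"
    by (auto simp: complex_eq_iff)
  then show False by (simp add: sin_120)
qed


section \<open>Families of triangles of cube roots\<close>

definition complex_to_plane :: "complex \<Rightarrow> real^2" where
  "complex_to_plane z = vector [Re z, Im z]"

lemma linear_complex_to_plane: "linear complex_to_plane"
  by (auto simp: complex_to_plane_def linear_iff vec_eq_iff forall_2)

lemma dist_complex_to_plane: "dist (complex_to_plane z) (complex_to_plane w) = dist z w"
  by (simp add: complex_to_plane_def dist_vec_def L2_set_def sum_2 dist_norm cmod_def dist_real_def)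

lemma inj_complex_to_plane: "inj complex_to_plane"
  by (metis injI dist_eq_0_iff dist_complex_to_plane)

lemma equilateral_not_collinear:
  fixes a b c :: "'a::euclidean_space"
  assumes "dist a b = l" "dist a c = l" "dist b c = l" "l > 0"
  shows "\<not> collinear {a, b, c}"
  using assms by (auto simp: collinear_between_cases between dist_commute)

definition cube_root_family ::
  "'x::metric_space set \<Rightarrow> ('x \<Rightarrow> complex) \<Rightarrow> ('x \<times> complex, 'x) family" where
  "cube_root_family S f =
     \<lparr> total = top_of_set {(u, w). u \<in> S \<and> w \<in> triangle_of (f u)},
       proj = fst,
       fdist = (\<lambda>a b. dist (snd a) (snd b)) \<rparr>"

lemma fibre_cube_root_family:
  "u \<in> S \<Longrightarrow> fibre (cube_root_family S f) u = {u} \<times> triangle_of (f u)"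
  by (auto simp: fibre_def cube_root_family_def)

lemma endpoint_ordering_cube_root_family:
  assumes "u \<in> S" "f u = r ^ 3" "norm r = 1"
  shows "endpoint_ordering (fibre (cube_root_family S f) u) (fdist (cube_root_family S f))
           (u, r) (u, r * root3) (u, r * root3\<^sup>2)"
proof -
  let ?J = complex_to_plane
  let ?T = "{r, r * root3, r * root3\<^sup>2}"
  have d: "dist (?J r) (?J (r * root3)) = sqrt 3" "dist (?J r) (?J (r * root3\<^sup>2)) = sqrt 3"
      "dist (?J (r * root3)) (?J (r * root3\<^sup>2)) = sqrt 3"
    by (simp_all add: dist_complex_to_plane dist_cube_roots[OF assms(3)])
  have fib: "fibre (cube_root_family S f) u = {u} \<times> (convex hull ?T)"
    by (simp add: fibre_cube_root_family assms(1,2) triangle_of_cube)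
  have "?J ` (convex hull ?T) = convex hull {?J r, ?J (r * root3), ?J (r * root3\<^sup>2)}"
    by (simp add: convex_hull_linear_image[OF linear_complex_to_plane])
  moreover have "bij_betw (?J \<circ> snd) ({u} \<times> (convex hull ?T)) (?J ` (convex hull ?T))"
    by (auto simp: bij_betw_def inj_on_def inj_eq[OF inj_complex_to_plane] image_iff)
  ultimately have "isometry_onto ({u} \<times> (convex hull ?T)) (fdist (cube_root_family S f))
      (convex hull {?J r, ?J (r * root3), ?J (r * root3\<^sup>2)}) (?J \<circ> snd)"
    by (simp add: isometry_onto_def cube_root_family_def dist_complex_to_plane)
  moreover have "\<not> collinear {?J r, ?J (r * root3), ?J (r * root3\<^sup>2)}"
    using d by (intro equilateral_not_collinear) auto
  moreover have "?T \<subseteq> convex hull ?T" by (rule hull_subset)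
  ultimately show ?thesis
    unfolding endpoint_ordering_def fib by (intro conjI exI[of _ "?J \<circ> snd"]) auto
qed

lemma endpoint_ordering_imp_isometric_to_triangle:
  "endpoint_ordering M d A B C \<Longrightarrow> isometric_to_triangle M d"
  unfolding endpoint_ordering_def isometric_to_triangle_def plane_triangle_def by blast


lemma compact_triangle_of: "compact (triangle_of (r ^ 3))"
  unfolding triangle_of_def cube_roots_eq by (simp add: finite_imp_compact_convex_hull)

text \<open>Near \<open>u0\<close> the quotient \<open>f u / f u0\<close> avoids the cut of the principal logarithm, which then supplies
  a continuous cube root of it. These local cube roots trivialise the family.\<close>

lemma local_cube_root:
  fixes f :: "'x::topological_space \<Rightarrow> complex"
  assumes f: "continuous_on S f" "\<And>u. u \<in> S \<Longrightarrow> norm (f u) = 1" and u0: "u0 \<in> S"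
  obtains U \<rho> where "openin (top_of_set S) U" "u0 \<in> U" "continuous_on U \<rho>"
    "\<And>u. u \<in> U \<Longrightarrow> \<rho> u ^ 3 = f u" "\<And>u. u \<in> U \<Longrightarrow> norm (\<rho> u) = 1"
proof -
  define U where "U = S \<inter> (\<lambda>u. f u / f u0) -` (- \<real>\<^sub>\<le>\<^sub>0)"
  obtain r where r: "r ^ 3 = f u0"
    using cube_root_exists f(2)[OF u0] by blast
  define \<rho> where "\<rho> u = r * exp (Ln (f u / f u0) / 3)" for u
  have nz: "f u \<noteq> 0" if "u \<in> S" for u
    using f(2)[OF that] by auto
  have US: "U \<subseteq> S" by (auto simp: U_def)
  have cont: "continuous_on S (\<lambda>u. f u / f u0)"
    using f(1) nz[OF u0] by (auto intro!: continuous_intros)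
  have 1: "openin (top_of_set S) U"
    unfolding U_def using cont
    by (rule continuous_openin_preimage_gen) (simp add: open_Compl closed_nonpos_Reals_complex)
  have 2: "u0 \<in> U"
    using u0 nz[OF u0] by (simp add: U_def)
  have 3: "continuous_on U \<rho>"
    unfolding \<rho>_def using continuous_on_subset[OF cont US]
    by (auto intro!: continuous_intros simp: U_def)
  have 4: "\<rho> u ^ 3 = f u" if "u \<in> U" for u
  proof -
    have "exp (Ln (f u / f u0) / 3) ^ 3 = f u / f u0"
      using nz US that u0 by (simp flip: exp_of_nat_mult) auto
    then show ?thesis
      using nz[OF u0] r by (simp add: \<rho>_def power_mult_distrib)
  qed
  have 5: "norm (\<rho> u) = 1" if "u \<in> U" for u
    using 4[OF that] f(2) US that by (intro norm_eq_1_if_cube[of "\<rho> u"]) auto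
  show ?thesis
    by (rule that[OF 1 2 3 4 5])
qed

text \<open>A global cube root being unavailable, the total space is presented as the image of the compact
  space of all triples \<open>(u, r, v)\<close> with \<open>r ^ 3 = f u\<close> and \<open>v\<close> in the standard triangle.\<close>

lemma compact_total_cube_root_family:
  fixes f :: "'x::metric_space \<Rightarrow> complex"
  assumes S: "compact S" and f: "continuous_on S f" "\<And>u. u \<in> S \<Longrightarrow> norm (f u) = 1"
  shows "compact {(u, w). u \<in> S \<and> w \<in> triangle_of (f u)}"
proof -
  let ?P = "S \<times> sphere (0 :: complex) 1 \<times> triangle_of 1"
  let ?D = "{z \<in> ?P. fst (snd z) ^ 3 - f (fst z) = 0}"
  let ?m = "\<lambda>z :: 'x \<times> complex \<times> complex. (fst z, fst (snd z) * snd (snd z))"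
  have P: "compact ?P"
    using compact_triangle_of[of 1] S by (intro compact_Times compact_sphere) simp_all
  have "continuous_on ?P (\<lambda>z. fst (snd z) ^ 3 - f (fst z))"
    by (intro continuous_intros continuous_on_compose2[OF f(1)]) auto
  then have "closed ?D"
    by (rule continuous_closed_preimage_constant) (rule compact_imp_closed[OF P])
  then have "compact (?P \<inter> ?D)"
    by (rule compact_Int_closed[OF P])
  then have "compact (?m ` (?P \<inter> ?D))"
    by (rule compact_continuous_image[rotated]) (intro continuous_intros)
  moreover have "?m ` (?P \<inter> ?D) = {(u, w). u \<in> S \<and> w \<in> triangle_of (f u)}"
  proof (intro equalityI subsetI)
    fix e assume "e \<in> ?m ` (?P \<inter> ?D)"
    then obtain u r v where "e = (u, r * v)" "u \<in> S" "r ^ 3 = f u" "v \<in> triangle_of 1"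
      by auto
    then show "e \<in> {(u, w). u \<in> S \<and> w \<in> triangle_of (f u)}"
      using triangle_of_mult[of r 1] by auto
  next
    fix e assume "e \<in> {(u, w). u \<in> S \<and> w \<in> triangle_of (f u)}"
    then obtain u w where e: "e = (u, w)" "u \<in> S" "w \<in> triangle_of (f u)" by auto
    obtain r where r: "r ^ 3 = f u" "norm r = 1"
      using cube_root_exists f(2)[OF e(2)] by blast
    then obtain v where "w = r * v" "v \<in> triangle_of 1"
      using triangle_of_mult[of r 1] e(3) by auto
    then show "e \<in> ?m ` (?P \<inter> ?D)"
      using e r by (intro image_eqI[of _ _ "(u, r, v)"]) auto
  qed
  ultimately show ?thesis by simp
qed

lemma fibre_bundle_cube_root_family:
  fixes f :: "'x::metric_space \<Rightarrow> complex"
  assumes f: "continuous_on S f" "\<And>u. u \<in> S \<Longrightarrow> norm (f u) = 1"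
  shows "fibre_bundle (top_of_set S) (total (cube_root_family S f)) (proj (cube_root_family S f))"
proof -
  let ?E = "{(u, w). u \<in> S \<and> w \<in> triangle_of (f u)}"
  \<comment> \<open>The model fibre has to live in the type of the total space; the first coordinate is padding.\<close>
  let ?K = "{undefined :: 'x} \<times> triangle_of 1"
  have "\<exists>U. openin (top_of_set S) U \<and> u0 \<in> U \<and>
      (\<exists>\<phi>. homeomorphic_map (subtopology (top_of_set ?E) {e \<in> ?E. fst e \<in> U})
               (prod_topology (subtopology (top_of_set S) U) (top_of_set ?K)) \<phi> \<and>
            (\<forall>e\<in>?E. fst e \<in> U \<longrightarrow> fst (\<phi> e) = fst e))"
    if "u0 \<in> S" for u0
  proof -
    obtain U \<rho> where U: "openin (top_of_set S) U" "u0 \<in> U" and \<rho>: "continuous_on U \<rho>"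
        "\<And>u. u \<in> U \<Longrightarrow> \<rho> u ^ 3 = f u" "\<And>u. u \<in> U \<Longrightarrow> norm (\<rho> u) = 1"
      using local_cube_root[OF f \<open>u0 \<in> S\<close>] by metis
    have US: "U \<subseteq> S" using U(1) by (rule openin_imp_subset)
    have nz: "\<rho> u \<noteq> 0" if "u \<in> U" for u using \<rho>(3)[OF that] by auto
    have tri: "triangle_of (f u) = (*) (\<rho> u) ` triangle_of 1" if "u \<in> U" for u
      using triangle_of_mult[of "\<rho> u" 1] \<rho>(2)[OF that] by simp
    let ?V = "{e \<in> ?E. fst e \<in> U}"
    let ?\<phi> = "\<lambda>e. (fst e, (undefined :: 'x, snd e / \<rho> (fst e)))"
    let ?\<psi> = "\<lambda>z. (fst z, \<rho> (fst z) * snd (snd z))"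
    have "continuous_on ?V ?\<phi>"
      by (intro continuous_intros continuous_on_compose2[OF \<rho>(1)]) (auto simp: nz)
    moreover have "continuous_on (U \<times> ?K) ?\<psi>"
      by (intro continuous_intros continuous_on_compose2[OF \<rho>(1)]) auto
    moreover have "?\<phi> \<in> ?V \<rightarrow> U \<times> ?K"
      by (auto simp: tri nz)
    moreover have "?\<psi> \<in> U \<times> ?K \<rightarrow> ?V"
      using US by (auto simp: tri)
    ultimately have "homeomorphic_maps (top_of_set ?V) (top_of_set (U \<times> ?K)) ?\<phi> ?\<psi>"
      unfolding homeomorphic_maps_def continuous_map_subtopology_eu by (auto simp: nz)
    then have "homeomorphic_map (top_of_set ?V) (top_of_set (U \<times> ?K)) ?\<phi>"
      by (rule homeomorphic_maps_imp_map)
    moreover have "subtopology (top_of_set ?E) ?V = top_of_set ?V"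
    proof -
      have "?E \<inter> ?V = ?V" by blast
      then show ?thesis by (simp only: subtopology_subtopology)
    qed
    moreover have "prod_topology (subtopology (top_of_set S) U) (top_of_set ?K) = top_of_set (U \<times> ?K)"
      using US by (simp add: subtopology_subtopology inf.absorb2)
    ultimately have "homeomorphic_map (subtopology (top_of_set ?E) ?V)
        (prod_topology (subtopology (top_of_set S) U) (top_of_set ?K)) ?\<phi>"
      by (simp only:)
    then show ?thesis
      using U by (intro exI[of _ U] conjI exI[of _ ?\<phi>]) (simp_all only: fst_conv ball_triv simp_thms)
  qed
  moreover have "continuous_map (top_of_set ?E) (top_of_set S) fst"
    by (auto simp: continuous_map_subtopology_eu intro!: continuous_intros)
  ultimately have "fibre_bundle (top_of_set S) (top_of_set ?E) fst"
    unfolding fibre_bundle_def topspace_euclidean_subtopology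
    by (intro conjI exI[of _ "top_of_set ?K"] ballI)
  then show ?thesis
    by (simp add: cube_root_family_def)
qed

lemma continuous_family_cube_root_family:
  fixes f :: "'x::metric_space \<Rightarrow> complex"
  assumes S: "compact S" and f: "continuous_on S f" "\<And>u. u \<in> S \<Longrightarrow> norm (f u) = 1"
  shows "continuous_family (top_of_set S) (cube_root_family S f)"
proof -
  let ?F = "cube_root_family S f"
  let ?E = "{(u, w). u \<in> S \<and> w \<in> triangle_of (f u)}"
  have fib: "fibre_bundle (top_of_set S) (total ?F) (proj ?F)"
    using f by (rule fibre_bundle_cube_root_family)
  then have cont: "continuous_map (total ?F) (top_of_set S) (proj ?F)"
    by (simp add: fibre_bundle_def)
  moreover have "compact_space (total ?F)"
    using compact_total_cube_root_family[OF S f]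
    by (simp add: cube_root_family_def compact_space_subtopology)
  ultimately have proper: "proper_map (total ?F) (top_of_set S) (proj ?F)"
    by (intro continuous_imp_proper_map Hausdorff_imp_kc_space Hausdorff_space_subtopology) auto
  have "continuous_on (?E \<times> ?E \<inter> {(a, b). fst a = fst b})
      (\<lambda>(a, b). dist (snd a) (snd b))"
    by (auto simp: case_prod_unfold intro!: continuous_intros)
  then have dist: "continuous_map
       (subtopology (prod_topology (total ?F) (total ?F)) {(a, b). proj ?F a = proj ?F b})
       (top_of_set {0..}) (\<lambda>(a, b). fdist ?F a b)"
    by (auto simp: cube_root_family_def subtopology_subtopology continuous_map_subtopology_eu)
  have metric: "metric_on (fibre ?F u) (fdist ?F)" if "u \<in> S" for u
    unfolding metric_on_def fibre_cube_root_family[OF that]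
    by unfold_locales (auto simp: cube_root_family_def dist_commute dist_triangle)
  \<comment> \<open>The cube roots are chosen pointwise, without continuity: the three side lengths are constant
    all the same.\<close>
  define r where "r u = (SOME r. r ^ 3 = f u \<and> norm r = 1)" for u
  have r: "f u = r u ^ 3" "norm (r u) = 1" if "u \<in> S" for u
    using someI_ex[of "\<lambda>r. r ^ 3 = f u \<and> norm r = 1"] cube_root_exists f(2)[OF that]
    unfolding r_def by metis+
  let ?A = "\<lambda>u. (u, r u)" and ?B = "\<lambda>u. (u, r u * root3)" and ?C = "\<lambda>u. (u, r u * root3\<^sup>2)"
  have ep: "endpoint_ordering (fibre ?F u) (fdist ?F) (?A u) (?B u) (?C u)" if "u \<in> S" for u
    using that r[OF that] by (rule endpoint_ordering_cube_root_family)
  have const: "continuous_map (top_of_set S) (top_of_set {0..}) d"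
    if "\<And>u. u \<in> S \<Longrightarrow> d u = sqrt 3" for d :: "'x \<Rightarrow> real"
    by (rule continuous_map_eq[of _ _ "\<lambda>_. sqrt 3"]) (auto simp: that)
  have cA: "continuous_map (top_of_set S) (top_of_set {0..}) (\<lambda>u. fdist ?F (?A u) (?B u))"
    "continuous_map (top_of_set S) (top_of_set {0..}) (\<lambda>u. fdist ?F (?A u) (?C u))"
    "continuous_map (top_of_set S) (top_of_set {0..}) (\<lambda>u. fdist ?F (?B u) (?C u))"
    by (rule const, simp add: cube_root_family_def dist_cube_roots r(2))+
  have tri: "isometric_to_triangle (fibre ?F u) (fdist ?F)" if "u \<in> S" for u
    using ep[OF that] by (rule endpoint_ordering_imp_isometric_to_triangle)
  show ?thesis
    unfolding continuous_family_def topspace_euclidean_subtopology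
    using cont proper fib dist metric tri ep cA
    by (intro conjI ballI exI[of _ ?A] exI[of _ ?B] exI[of _ ?C])
qed

lemma cube_root_family_fibres_isometric:
  assumes "u \<in> S" "norm (f u) = 1" "norm (g u) = 1"
  shows "\<exists>h. bij_betw h (fibre (cube_root_family S f) u) (fibre (cube_root_family S g) u) \<and>
    (\<forall>a\<in>fibre (cube_root_family S f) u. \<forall>b\<in>fibre (cube_root_family S f) u.
       fdist (cube_root_family S g) (h a) (h b) = fdist (cube_root_family S f) a b)"
proof -
  obtain r s where r: "r ^ 3 = f u" "norm r = 1" and s: "s ^ 3 = g u" "norm s = 1"
    using cube_root_exists assms(2,3) by metis
  have nz: "r \<noteq> 0" "s \<noteq> 0" using r s by auto
  have "(s / r) ^ 3 * r ^ 3 = s ^ 3"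
    using nz by (simp add: power_divide)
  then have tri: "triangle_of (g u) = (*) (s / r) ` triangle_of (f u)"
    using triangle_of_mult[of "s / r" r] r s by simp
  let ?h = "\<lambda>a. (fst a, s / r * snd a)"
  have "bij_betw ?h ({u} \<times> triangle_of (f u)) ({u} \<times> triangle_of (g u))"
    unfolding tri using nz by (auto simp: bij_betw_def inj_on_def image_iff)
  moreover have "dist (s / r * a) (s / r * b) = dist a b" for a b
    using r(2) s(2) by (simp add: dist_mult_unit norm_divide del: times_divide_eq_left)
  ultimately show ?thesis
    unfolding fibre_cube_root_family[OF assms(1)]
    by (intro exI[of _ ?h]) (simp add: cube_root_family_def)
qed

text \<open>The constant family has the constant section \<open>1\<close>, which runs through vertices. The vertices of
  \<open>triangle_of 1\<close> have mutual distance \<open>sqrt 3\<close>, so an isomorphism sends them to three points of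
  the disc at these distances, that is, to vertices. The image of the section \<open>1\<close> is therefore a
  continuous choice of a cube root of \<open>f\<close>.\<close>

lemma cube_root_if_isomorphic:
  fixes f :: "'x::metric_space \<Rightarrow> complex"
  assumes f: "\<And>u. u \<in> S \<Longrightarrow> norm (f u) = 1"
    and iso: "isomorphic_families (top_of_set S) (cube_root_family S (\<lambda>_. 1)) (cube_root_family S f)"
  obtains s where "continuous_on S s" "\<And>u. u \<in> S \<Longrightarrow> s u ^ 3 = f u"
proof -
  let ?F = "cube_root_family S (\<lambda>_. 1)" and ?G = "cube_root_family S f"
  obtain \<phi> where \<phi>: "homeomorphic_map (total ?F) (total ?G) \<phi>"
      and p: "\<forall>e \<in> topspace (total ?F). proj ?G (\<phi> e) = proj ?F e"
      and d: "\<forall>u \<in> topspace (top_of_set S). \<forall>a \<in> fibre ?F u. \<forall>b \<in> fibre ?F u.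
                fdist ?G (\<phi> a) (\<phi> b) = fdist ?F a b"
    using iso unfolding isomorphic_families_def by blast
  define s where "s u = snd (\<phi> (u, 1))" for u
  have vert: "{1, root3, root3\<^sup>2} \<subseteq> triangle_of 1"
    using triangle_of_cube[of 1] hull_subset[of "{1, root3, root3\<^sup>2}" convex] by simp
  have c: "continuous_map (total ?F) (total ?G) \<phi>"
    using \<phi> by (simp add: homeomorphic_eq_everything_map)
  then have "continuous_on (S \<times> triangle_of 1) \<phi>"
    by (auto simp: cube_root_family_def continuous_map_subtopology_eu Sigma_def
        elim!: continuous_on_subset)
  then have "continuous_on S (\<lambda>u. \<phi> (u, 1))"
    by (rule continuous_on_compose2) (use vert in \<open>auto intro!: continuous_intros\<close>)
  then have "continuous_on S s"
    unfolding s_def by (intro continuous_intros)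
  moreover have "s u ^ 3 = f u" if u: "u \<in> S" for u
  proof -
    have fib: "snd (\<phi> (u, w)) \<in> triangle_of (f u)" if "w \<in> triangle_of 1" for w
    proof -
      have e: "(u, w) \<in> topspace (total ?F)"
        using that u by (simp add: cube_root_family_def)
      then have "\<phi> (u, w) \<in> topspace (total ?G)"
        using c by (auto simp: continuous_map_def)
      moreover have "fst (\<phi> (u, w)) = u"
        using p e by (auto simp: cube_root_family_def)
      ultimately show ?thesis
        by (auto simp: cube_root_family_def)
    qed
    have dist: "dist (snd (\<phi> (u, v))) (snd (\<phi> (u, w))) = dist v w"
      if "v \<in> triangle_of 1" "w \<in> triangle_of 1" for v w
    proof -
      have "fdist ?G (\<phi> (u, v)) (\<phi> (u, w)) = fdist ?F (u, v) (u, w)"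
        using d u that by (simp add: fibre_cube_root_family[OF u])
      then show ?thesis by (simp add: cube_root_family_def)
    qed
    have "norm (s u) = 1"
      unfolding s_def
    proof (rule far_points_in_disc)
      show "dist (snd (\<phi> (u, 1))) (snd (\<phi> (u, root3))) = sqrt 3"
        "dist (snd (\<phi> (u, 1))) (snd (\<phi> (u, root3\<^sup>2))) = sqrt 3"
        "dist (snd (\<phi> (u, root3))) (snd (\<phi> (u, root3\<^sup>2))) = sqrt 3"
        using vert dist_cube_roots[of 1] by (simp_all add: dist)
    qed (use vert fib norm_triangle_of_le[OF f[OF u]] in auto)
    then show ?thesis
      using unit_point_of_triangle[OF f[OF u]] fib[of 1] vert by (simp add: s_def)
  qed
  ultimately show ?thesis by (rule that)
qed


section \<open>Two families over the circle\<close>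

theorem mainTheorem3:
  assumes universe_large: "\<exists>\<iota> :: real \<Rightarrow> 'u. inj \<iota>"
  shows "\<not> fine_moduli_space
           (moduli_obj :: 'u topology \<Rightarrow> ('u, 'u) family set set) moduli_map triangle_space"
proof
  assume fine: "fine_moduli_space
      (moduli_obj :: 'u topology \<Rightarrow> ('u, 'u) family set set) moduli_map triangle_space"
  obtain i :: "complex \<Rightarrow> 'u" and k :: "complex \<times> complex \<Rightarrow> 'u" where i: "inj i" and k: "inj k"
    using universe_large inj_complex by metis
  let ?S = "sphere 0 1 :: complex set"
  let ?F = "cube_root_family ?S (\<lambda>_. 1)" and ?G = "cube_root_family ?S (\<lambda>u. u)"
  let ?X = "push_topology i (top_of_set ?S)"
  have F: "continuous_family (top_of_set ?S) ?F"
    by (rule continuous_family_cube_root_family) simp_all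
  have G: "continuous_family (top_of_set ?S) ?G"
    by (rule continuous_family_cube_root_family) simp_all
  have "isomorphic_families ?X (push_family i k ?F) (push_family i k ?G)"
  proof (rule fine_moduli_space_fibrewise[OF fine])
    fix x assume "x \<in> topspace ?X"
    then obtain u where u: "u \<in> ?S" "x = i u"
      by (auto simp: topspace_push_topology[OF i])
    then obtain h where h: "bij_betw h (fibre ?F u) (fibre ?G u)"
        "\<forall>a\<in>fibre ?F u. \<forall>b\<in>fibre ?F u. fdist ?G (h a) (h b) = fdist ?F a b"
      using cube_root_family_fibres_isometric[of u ?S "\<lambda>_. 1" "\<lambda>u. u"] by auto
    show "\<exists>h. bij_betw h (fibre (push_family i k ?F) x) (fibre (push_family i k ?G) x) \<and>
        (\<forall>a\<in>fibre (push_family i k ?F) x. \<forall>b\<in>fibre (push_family i k ?F) x.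
           fdist (push_family i k ?G) (h a) (h b) = fdist (push_family i k ?F) a b)"
      unfolding u(2) fibre_push_family[OF i k]
    proof (intro exI[of _ "k \<circ> h \<circ> inv k"] conjI ballI)
      have "bij_betw (inv k) (k ` fibre ?F u) (fibre ?F u)"
        using k by (auto simp: bij_betw_def inj_on_def image_comp)
      moreover have "bij_betw k (fibre ?G u) (k ` fibre ?G u)"
        using k by (auto simp: bij_betw_def intro: inj_on_subset)
      ultimately show "bij_betw (k \<circ> h \<circ> inv k) (k ` fibre ?F u) (k ` fibre ?G u)"
        using h(1) by (metis bij_betw_trans comp_assoc)
    qed (use h(2) in \<open>auto simp: fdist_push_family[OF k] k\<close>)
  qed (intro continuous_family_push i k F G)+
  then have "isomorphic_families (top_of_set ?S) ?F ?G"
    by (rule isomorphic_families_push_cancel[OF i k])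
  then obtain s where "continuous_on ?S s" "\<And>u. u \<in> ?S \<Longrightarrow> s u ^ 3 = u"
    using cube_root_if_isomorphic[of ?S "\<lambda>u. u"] by auto
  then show False
    by (intro no_continuous_cube_root[of s]) auto
qed

end
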